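(* Let $d\geq 3$ be an integer and let $\psi:\mathbb{N}\to[0,\infty)$ be a non-increasing function such that every set $A\subseteq\mathbb{N}$ for which $\sum_{q\in A}\psi(q)^d$ converges has asymptotic density $\operatorname{d}(A)=0$. Then for every $x\in\mathbb{R}$, the set $\mathcal{W}_d(\psi)\cap(\{x\}\times\mathbb{R}^{d-1})$ has full $(d-1)$-dimensional Lebesgue measure in $\{x\}\times\mathbb{R}^{d-1}$; that is, for Lebesgue-almost every $(x_2,\dots,x_d)\in\mathbb{R}^{d-1}$ one has $(x,x_2,\dots,x_d)\in\mathcal{W}_d(\psi)$.
   Context: For $\psi:\mathbb{N}\to[0,\infty)$, $\mathcal{W}_d(\psi)$ is the set of $\boldsymbol{x}\in\mathbb{R}^d$ such that $\|q\boldsymbol{x}-\boldsymbol{p}\|_\infty<\psi(q)$ holds for infinitely many $(\boldsymbol{p},q)\in\mathbb{Z}^d\times\mathbb{N}$. The asymptotic density of $A\subseteq\mathbb{N}$ is $\operatorname{d}(A)=\lim_{N\to\infty}|A\cap[1,N]|/N$ when the limit exists. *)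

theory Defs
  imports "HOL-Analysis.Analysis"
begin

text \<open>
  The dimension is a number occurring in the formulas (as the exponent d, and next to d - 1), so
  a point of R^d is an extensional function on the index set \<open>{1..d}\<close>, and the coordinates
  (x_2, ..., x_d) form an extensional function on \<open>{2..d}\<close>; then (x, x_2, ..., x_d) is
  \<open>y(1 := x)\<close>. The natural numbers of the source start at 1; values at 0 are ignored.
\<close>

definition real_space :: "nat set \<Rightarrow> (nat \<Rightarrow> real) set" where
  "real_space I = (I \<rightarrow>\<^sub>E UNIV)"

text \<open>Integer vectors are extensional too, so that distinct functions are distinct vectors
  when pairs (p, q) are counted.\<close>

definition int_space :: "nat set \<Rightarrow> (nat \<Rightarrow> int) set" where
  "int_space I = (I \<rightarrow>\<^sub>E UNIV)"

text \<open>Only meaningful for nonempty finite \<open>I\<close>.\<close>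

definition sup_norm :: "nat set \<Rightarrow> (nat \<Rightarrow> real) \<Rightarrow> real" where
  "sup_norm I v = Max ((\<lambda>i. \<bar>v i\<bar>) ` I)"

definition well_approximable :: "nat \<Rightarrow> (nat \<Rightarrow> real) \<Rightarrow> (nat \<Rightarrow> real) set" where
  "well_approximable d \<psi> =
    {x \<in> real_space {1..d}.
       infinite {(p, q). p \<in> int_space {1..d} \<and> q \<ge> 1 \<and>
         sup_norm {1..d} (\<lambda>i. real q * x i - real_of_int (p i)) < \<psi> q}}"

definition has_asymptotic_density :: "nat set \<Rightarrow> real \<Rightarrow> bool" where
  "has_asymptotic_density A \<delta> \<longleftrightarrow>
     (\<lambda>N. real (card (A \<inter> {1..N})) / real N) \<longlonglongrightarrow> \<delta>"

definition lebesgue_space :: "nat set \<Rightarrow> (nat \<Rightarrow> real) measure" where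
  "lebesgue_space I = completion (Pi\<^sub>M I (\<lambda>_. lborel))"

end

theory Submission
  imports Defs
begin

text \<open>
  Testing the hypothesis on unions of blocks \<open>(N, 2N]\<close>, which have positive upper density, shows
  that \<open>\<psi> q \<ge> c * q powr (-1/d)\<close> for some \<open>c > 0\<close> and all large q. Dirichlet's pigeonhole
  argument for a skew box gives, for every point z of R^d, infinitely many q for which \<open>q * z\<close> is
  within \<open>c * q powr (-1/d)\<close> of the integers in the first coordinate and within
  \<open>C * q powr (-1/d)\<close> in the others. The constant C is then replaced by c in one coordinate after
  another: on the line, shrinking all intervals of a limsup set by a constant factor changes it only
  by a null set (Cassels), because a point lost in the process is never a density point of the set
  of lost points; Fubini's theorem lifts this to R^(d-1).
\<close>

section \<open>Vitali coverings and the shrinking of limsup sets on the line\<close>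

text \<open>By Vitali, almost all of a bounded piece \<open>B\<close> of \<open>S\<close> is covered
  by disjoint small balls in which \<open>S\<close> has proportion at most \<open>\<theta>\<close>.
  Taken inside an open \<open>T\<close> barely larger than \<open>B\<close>, these balls show that
  the measure of \<open>B\<close> is at most \<open>\<theta>\<close> times that of \<open>T\<close>,
  which forces it to be 0. The balls only have to contain \<open>x\<close>; they need not be centred
  there.\<close>

lemma null_set_lborel_if_density_gap:
  fixes S :: "'a::euclidean_space set" and \<theta> :: real
  assumes S: "S \<in> sets borel" and \<theta>: "0 \<le> \<theta>" "\<theta> < 1"
    and gap: "\<And>x e. x \<in> S \<Longrightarrow> 0 < e \<Longrightarrow> \<exists>a r. 0 < r \<and> r < e \<and> x \<in> ball a r \<and>
      emeasure lborel (S \<inter> ball a r) \<le> ennreal \<theta> * emeasure lborel (ball a r)"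
  shows "S \<in> null_sets lborel"
proof -
  have "S \<inter> ball 0 (real n) \<in> null_sets lborel" for n
  proof -
    define B where "B = S \<inter> ball 0 (real n)"
    have B: "B \<in> sets borel" unfolding B_def using S by auto
    have "emeasure lborel B \<le> emeasure lborel (ball (0::'a) (real n))"
      unfolding B_def using S by (intro emeasure_mono) auto
    also have "\<dots> < \<infinity>" by (rule emeasure_bounded_finite) auto
    finally obtain m where m: "0 \<le> m" "emeasure lborel B = ennreal m"
      by (cases "emeasure lborel B") auto
    have "m = 0"
    proof (rule ccontr)
      assume "m \<noteq> 0"
      \<comment> \<open>Chosen so that \<open>\<theta> * (m + e) < m\<close>: the difference is
        \<open>m * (1 - \<theta>)\<^sup>2\<close>.\<close>
      define e where "e = m * (1 - \<theta>)"
      have e: "e > 0" using \<open>m \<noteq> 0\<close> m(1) \<theta> by (simp add: e_def)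
      obtain T where T: "open T" "B \<subseteq> T" "emeasure lebesgue (T - B) < ennreal e"
        using sets_lebesgue_outer_open[of B e] B e by (metis sets_completionI_sets sets_lborel)
      define K where "K = {p::'a \<times> real. 0 < snd p \<and> ball (fst p) (snd p) \<subseteq> T \<and>
        emeasure lborel (S \<inter> ball (fst p) (snd p)) \<le> ennreal \<theta> * emeasure lborel (ball (fst p) (snd p))}"
      have "\<exists>i. i \<in> K \<and> x \<in> ball (fst i) (snd i) \<and> snd i < d" if x: "x \<in> B" and d: "0 < d" for x d
      proof -
        obtain k where k: "k > 0" "ball x k \<subseteq> T" using T x by (meson openE subsetD)
        \<comment> \<open>A ball of radius below \<open>k/2\<close> that contains \<open>x\<close>
          lies within distance \<open>k\<close> of \<open>x\<close>, hence inside
          \<open>T\<close>.\<close>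
        obtain a r where ar: "0 < r" "r < min d (k/2)" "x \<in> ball a r"
          "emeasure lborel (S \<inter> ball a r) \<le> ennreal \<theta> * emeasure lborel (ball a r)"
          using gap[of x "min d (k/2)"] x d k by (auto simp: B_def)
        have "ball a r \<subseteq> ball x k"
        proof
          fix z assume "z \<in> ball a r"
          then have "dist x z \<le> dist x a + dist a z" "dist a z < r" "dist x a < r"
            using ar(3) dist_triangle[of x z a] by (auto simp: dist_commute)
          then show "z \<in> ball x k" using ar(2) by auto
        qed
        then show ?thesis using ar k by (intro exI[of _ "(a, r)"]) (auto simp: K_def)
      qed
      then obtain C where C: "countable C" "C \<subseteq> K"
        "pairwise (\<lambda>i j. disjnt (ball (fst i) (snd i)) (ball (fst j) (snd j))) C"
        "negligible (B - (\<Union>i\<in>C. ball (fst i) (snd i)))"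
        by (rule Vitali_covering_theorem_balls[of B K fst snd]) blast+
      let ?b = "\<lambda>i::'a \<times> real. ball (fst i) (snd i)"
      have disj: "disjoint_family_on ?b C"
        using C(3) by (auto simp: disjoint_family_on_def pairwise_def disjnt_def)
      have U: "(\<Union>i\<in>C. ?b i) \<in> sets lborel" by (simp add: open_UN)
      have null: "B - (\<Union>i\<in>C. ?b i) \<in> null_sets lborel"
        using C(4) B U by (simp add: negligible_iff_null_sets null_sets_completion_iff)
      have "emeasure lborel B = emeasure lborel (B \<inter> (\<Union>i\<in>C. ?b i))"
        using emeasure_Diff_null_set[OF null, of B] B by (simp add: Diff_Diff_Int)
      also have "\<dots> = emeasure lborel (\<Union>i\<in>C. B \<inter> ?b i)" by (simp only: Int_UN_distrib)
      also have "\<dots> = (\<integral>\<^sup>+i. emeasure lborel (B \<inter> ?b i) \<partial>count_space C)"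
        using B C(1) disj by (intro emeasure_UN_countable disjoint_family_on_bisimulation[OF disj]) auto
      also have "\<dots> \<le> (\<integral>\<^sup>+i. ennreal \<theta> * emeasure lborel (?b i) \<partial>count_space C)"
      proof (rule nn_integral_mono)
        fix i assume "i \<in> space (count_space C)"
        then have "i \<in> K" using C by auto
        have "emeasure lborel (B \<inter> ?b i) \<le> emeasure lborel (S \<inter> ?b i)"
          using S by (intro emeasure_mono) (auto simp: B_def)
        also have "\<dots> \<le> ennreal \<theta> * emeasure lborel (?b i)" using \<open>i \<in> K\<close> by (auto simp: K_def)
        finally show "emeasure lborel (B \<inter> ?b i) \<le> ennreal \<theta> * emeasure lborel (?b i)" .
      qed
      also have "\<dots> = ennreal \<theta> * (\<integral>\<^sup>+i. emeasure lborel (?b i) \<partial>count_space C)"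
        by (rule nn_integral_cmult) auto
      also have "(\<integral>\<^sup>+i. emeasure lborel (?b i) \<partial>count_space C) = emeasure lborel (\<Union>i\<in>C. ?b i)"
        using C(1) disj by (intro emeasure_UN_countable[symmetric]) auto
      also have "emeasure lborel (\<Union>i\<in>C. ?b i) \<le> emeasure lborel T"
        using C(2) T(1) by (intro emeasure_mono) (auto simp: K_def)
      also have "emeasure lborel T = emeasure lborel B + emeasure lborel (T - B)"
        using T(1,2) B by (subst plus_emeasure) (auto intro!: arg_cong[where f="emeasure lborel"])
      also have "emeasure lborel (T - B) \<le> ennreal e"
        using T(1,3) B by simp
      finally have "ennreal m \<le> ennreal \<theta> * (ennreal m + ennreal e)"
        using m by (simp add: mult_left_mono)
      also have "\<dots> = ennreal (\<theta> * (m + e))" using m \<theta> e by (simp add: ennreal_mult)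
      finally have "m \<le> \<theta> * (m + e)" using m \<theta> e by (subst (asm) ennreal_le_iff) auto
      moreover have "m - \<theta> * (m + e) = m * (1 - \<theta>)\<^sup>2"
        by (simp add: e_def algebra_simps power2_eq_square)
      moreover have "m * (1 - \<theta>)\<^sup>2 > 0" using m(1) \<open>m \<noteq> 0\<close> \<theta> by simp
      ultimately show False by linarith
    qed
    then show ?thesis using m B by (auto simp: B_def null_sets_def)
  qed
  then have "(\<Union>n. S \<inter> ball 0 (real n)) \<in> null_sets lborel" by blast
  moreover have "(\<Union>n. S \<inter> ball 0 (real n)) = S"
    using reals_Archimedean2 by (auto simp: dist_norm)
  ultimately show ?thesis by simp
qed

text \<open>If \<open>t\<close> is lost, it lies in arbitrarily small balls of radius
  \<open>D * \<phi> q / q\<close> about fractions \<open>p/q\<close>, while the concentric balls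
  with \<open>c\<close> in place of \<open>D\<close> contain no point lost from the same stage on.
  So the lost points fill at most the proportion \<open>1 - c/D\<close> of these balls. The set
  \<open>A\<close> of denominators is arbitrary so that it can later encode the conditions on the
  other coordinates.\<close>

lemma AE_infinite_close_shrink:
  fixes A :: "nat set" and \<phi> :: "nat \<Rightarrow> real" and c C :: real
  assumes A: "A \<subseteq> {1..}" and \<phi>: "\<And>q. q \<in> A \<Longrightarrow> 0 < \<phi> q"
    and lim: "(\<lambda>q. \<phi> q / real q) \<longlonglongrightarrow> 0" and c: "0 < c"
  shows "AE t in lborel. infinite {q\<in>A. \<exists>p::int. \<bar>real q * t - real_of_int p\<bar> < C * \<phi> q} \<longrightarrow>
    infinite {q\<in>A. \<exists>p::int. \<bar>real q * t - real_of_int p\<bar> < c * \<phi> q}"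
proof -
  \<comment> \<open>Enlarging \<open>C\<close> to at least \<open>c\<close> makes
    \<open>1 - c/D\<close> a number in [0, 1) whatever the sign or size of \<open>C\<close>.\<close>
  define D where "D = max C c"
  have D: "0 < D" "C \<le> D" "c \<le> D" using c by (auto simp: D_def)
  define close where "close b t = {q\<in>A. \<exists>p::int. \<bar>real q * t - real_of_int p\<bar> < b * \<phi> q}" for b t
  \<comment> \<open>Sorting the lost points by a bound \<open>M\<close> beyond which no
    \<open>q\<close> is \<open>c\<close>-close leaves countably many sets to treat.\<close>
  define F where "F M = {t. (\<forall>n. \<exists>q>n. q \<in> close D t) \<and> (\<forall>q>M. q \<notin> close c t)}" for M
  have meas: "F M \<in> sets borel" for M
    unfolding F_def close_def by measurable
  define \<theta> where "\<theta> = 1 - c / D"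
  have \<theta>: "0 \<le> \<theta>" "\<theta> < 1" using D c by (auto simp: \<theta>_def)
  have "F M \<in> null_sets lborel" for M
  proof (rule null_set_lborel_if_density_gap[OF meas \<theta>])
    fix t e :: real assume t: "t \<in> F M" and e: "0 < e"
    have "(\<lambda>q. D * (\<phi> q / real q)) \<longlonglongrightarrow> 0" using tendsto_mult_right_zero[OF lim] .
    then have "eventually (\<lambda>q. D * (\<phi> q / real q) < e) sequentially"
      using e by (rule order_tendstoD)
    then obtain N where N: "\<And>q. q \<ge> N \<Longrightarrow> D * (\<phi> q / real q) < e"
      by (auto simp: eventually_sequentially)
    \<comment> \<open>Here \<open>q > M\<close> keeps \<open>F M\<close> out of the inner ball, and
      \<open>q > N\<close> makes the radius of the outer ball smaller than \<open>e\<close>.\<close>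
    obtain q where q: "q > max M N" "q \<in> close D t" using t unfolding F_def by blast
    then obtain p :: int where p: "q \<in> A" "\<bar>real q * t - real_of_int p\<bar> < D * \<phi> q"
      by (auto simp: close_def)
    define a where "a = real_of_int p / real q"
    define \<rho> where "\<rho> = \<phi> q / real q"
    have q0: "real q > 0" using q by auto
    have \<rho>: "0 < \<rho>" using \<phi>[OF p(1)] q0 by (simp add: \<rho>_def)
    have dist: "\<bar>a - s\<bar> < b * \<rho> \<longleftrightarrow> \<bar>real q * s - real_of_int p\<bar> < b * \<phi> q" for s b
    proof -
      have "\<bar>real q * s - real_of_int p\<bar> = real q * \<bar>a - s\<bar>"
        using q0 by (simp add: a_def abs_if field_simps)
      then show ?thesis using q0 by (simp add: \<rho>_def field_simps)
    qed
    have sub: "F M \<inter> ball a (D * \<rho>) \<subseteq> ball a (D * \<rho>) - ball a (c * \<rho>)"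
      using q(1) p(1) dist by (auto simp: F_def close_def dist_real_def)
    have c\<rho>: "c * \<rho> \<le> D * \<rho>" using D \<rho> by simp
    have ball: "emeasure lborel (ball a (b * \<rho>)) = ennreal (2 * b * \<rho>)" if "b > 0" for b
      using that \<rho> by (simp add: ball_eq_greaterThanLessThan)
    have "emeasure lborel (F M \<inter> ball a (D * \<rho>)) \<le> emeasure lborel (ball a (D * \<rho>) - ball a (c * \<rho>))"
      using sub by (intro emeasure_mono) auto
    also have "\<dots> = ennreal (2 * D * \<rho>) - ennreal (2 * c * \<rho>)"
      using c\<rho> ball[OF D(1)] ball[OF c] by (subst emeasure_Diff) auto
    also have "\<dots> = ennreal (2 * D * \<rho> - 2 * c * \<rho>)"
      using c \<rho> by (intro ennreal_minus) auto
    also have "2 * D * \<rho> - 2 * c * \<rho> = \<theta> * (2 * D * \<rho>)"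
      using D by (simp add: \<theta>_def field_simps)
    also have "ennreal (\<theta> * (2 * D * \<rho>)) = ennreal \<theta> * emeasure lborel (ball a (D * \<rho>))"
      using ball[OF D(1)] \<theta> D \<rho> by (simp add: ennreal_mult)
    finally have 1: "emeasure lborel (F M \<inter> ball a (D * \<rho>)) \<le> ennreal \<theta> * emeasure lborel (ball a (D * \<rho>))" .
    have 2: "t \<in> ball a (D * \<rho>)" using p(2) dist by (simp add: dist_real_def)
    have 3: "D * \<rho> < e" using N[of q] q by (simp add: \<rho>_def)
    have 4: "0 < D * \<rho>" using D \<rho> by simp
    show "\<exists>a r. 0 < r \<and> r < e \<and> t \<in> ball a r \<and>
      emeasure lborel (F M \<inter> ball a r) \<le> ennreal \<theta> * emeasure lborel (ball a r)"
      using 1 2 3 4 by blast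
  qed
  then have "(\<Union>M. F M) \<in> null_sets lborel" by blast
  then have "AE t in lborel. t \<notin> (\<Union>M. F M)" by (rule AE_not_in)
  then show ?thesis
  proof (rule AE_mp, intro AE_I2 impI)
    fix t assume t: "t \<notin> (\<Union>M. F M)"
      and inf: "infinite {q\<in>A. \<exists>p::int. \<bar>real q * t - real_of_int p\<bar> < C * \<phi> q}"
    have "C * \<phi> q \<le> D * \<phi> q" if "q \<in> A" for q
      using \<phi>[OF that] D by simp
    then have "{q\<in>A. \<exists>p::int. \<bar>real q * t - real_of_int p\<bar> < C * \<phi> q} \<subseteq> close D t"
      unfolding close_def by (auto intro: less_le_trans)
    then have "infinite (close D t)" using inf finite_subset by blast
    then have "infinite (close c t)"
      using t unfolding infinite_nat_iff_unbounded by (auto simp: F_def)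
    then show "infinite {q\<in>A. \<exists>p::int. \<bar>real q * t - real_of_int p\<bar> < c * \<phi> q}"
      by (simp add: close_def)
  qed
qed

section \<open>Fubini and the change of the constant in one coordinate\<close>

text \<open>Tonelli: integrating the indicator of the exceptional set over coordinate
  \<open>i\<close> first gives 0 for every choice of the other coordinates.\<close>

lemma (in product_sigma_finite) AE_PiM_insert:
  assumes I: "finite I" "i \<notin> I"
    and meas: "{y \<in> space (Pi\<^sub>M (insert i I) M). P y} \<in> sets (Pi\<^sub>M (insert i I) M)"
    and slice: "\<And>y. y \<in> space (Pi\<^sub>M I M) \<Longrightarrow> AE t in M i. P (y(i := t))"
  shows "AE y in Pi\<^sub>M (insert i I) M. P y"
proof -
  let ?P = "Pi\<^sub>M (insert i I) M"
  define N where "N = {y \<in> space ?P. \<not> P y}"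
  have "N = space ?P - {y \<in> space ?P. P y}" by (auto simp: N_def)
  then have N: "N \<in> sets ?P" using meas by auto
  have "emeasure ?P N = (\<integral>\<^sup>+y. indicator N y \<partial>?P)" using N by simp
  also have "\<dots> = (\<integral>\<^sup>+y. (\<integral>\<^sup>+t. indicator N (y(i := t)) \<partial>M i) \<partial>Pi\<^sub>M I M)"
    using N I by (intro product_nn_integral_insert) auto
  also have "\<dots> = (\<integral>\<^sup>+y. 0 \<partial>Pi\<^sub>M I M)"
  proof (rule nn_integral_cong)
    fix y assume "y \<in> space (Pi\<^sub>M I M)"
    from slice[OF this] have "AE t in M i. indicator N (y(i := t)) = (0::ennreal)"
      by eventually_elim (simp add: N_def)
    then have "(\<integral>\<^sup>+t. indicator N (y(i := t)) \<partial>M i) = (\<integral>\<^sup>+t. 0 \<partial>M i)"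
      by (rule nn_integral_cong_AE)
    then show "(\<integral>\<^sup>+t. indicator N (y(i := t)) \<partial>M i) = 0" by simp
  qed
  finally have "N \<in> null_sets ?P" using N by (simp add: null_sets_def)
  then show ?thesis by (rule AE_I'[where N = N]) (auto simp: N_def)
qed

text \<open>The factor \<open>b\<close> varies with the coordinate so that it can be changed in one
  coordinate at a time. Only \<open>q\<close> is counted; the numerators are chosen separately in
  each coordinate, so the coordinates interact through \<open>q\<close> alone.\<close>

definition inf_close :: "nat set \<Rightarrow> (nat \<Rightarrow> real) \<Rightarrow> (nat \<Rightarrow> real) \<Rightarrow> (nat \<Rightarrow> real) \<Rightarrow> bool" where
  "inf_close I b \<phi> z \<longleftrightarrow>
    infinite {q. 1 \<le> q \<and> (\<forall>i\<in>I. \<exists>p::int. \<bar>real q * z i - real_of_int p\<bar> < b i * \<phi> q)}"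

lemma inf_close_cong:
  "(\<And>i. i \<in> I \<Longrightarrow> b i = b' i) \<Longrightarrow> inf_close I b \<phi> z \<longleftrightarrow> inf_close I b' \<phi> z"
  by (simp add: inf_close_def cong: ball_cong)

lemma measurable_inf_close:
  assumes I: "finite I" "I \<subseteq> insert k J"
  shows "Measurable.pred (Pi\<^sub>M J (\<lambda>_. lborel)) (\<lambda>y. inf_close I b \<phi> (y(k := x)))"
proof -
  have [measurable]: "(\<lambda>y. (y(k := x)) i) \<in> borel_measurable (Pi\<^sub>M J (\<lambda>_. lborel))" if "i \<in> I" for i
  proof (cases "i = k")
    case False
    then have "i \<in> J" using that I by auto
    then have "(\<lambda>y. y i) \<in> measurable (Pi\<^sub>M J (\<lambda>_. lborel)) (lborel :: real measure)"
      by (rule measurable_component_singleton)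
    then show ?thesis using False by simp
  qed simp
  have "Measurable.pred (Pi\<^sub>M J (\<lambda>_. lborel))
      (\<lambda>y. \<exists>p::int. \<bar>real q * (y(k := x)) i - real_of_int p\<bar> < b i * \<phi> q)" if "i \<in> I" for i q
    using that by measurable
  then have [measurable]: "Measurable.pred (Pi\<^sub>M J (\<lambda>_. lborel))
      (\<lambda>y. \<forall>i\<in>I. \<exists>p::int. \<bar>real q * (y(k := x)) i - real_of_int p\<bar> < b i * \<phi> q)" for q
    using I(1) by (intro pred_intros_finite)
  show ?thesis
    unfolding inf_close_def infinite_nat_iff_unbounded mem_Collect_eq by measurable
qed

text \<open>With all coordinates but \<open>i\<close> frozen, their conditions merely restrict
  \<open>q\<close> to a set \<open>A\<close> that does not depend on coordinate \<open>i\<close>.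
  The result on the line then applies to almost every value of that coordinate, and
  \<open>AE_PiM_insert\<close> assembles the slices.\<close>

lemma AE_inf_close_update:
  assumes I: "finite I" "I \<subseteq> insert k J" "i \<in> I" and J: "finite J" "i \<in> J" "i \<noteq> k"
    and \<phi>: "\<And>q. 1 \<le> q \<Longrightarrow> 0 < \<phi> q" "(\<lambda>q. \<phi> q / real q) \<longlonglongrightarrow> 0" and c: "0 < c"
  shows "AE y in Pi\<^sub>M J (\<lambda>_. lborel).
    inf_close I b \<phi> (y(k := x)) \<longrightarrow> inf_close I (b(i := c)) \<phi> (y(k := x))"
proof -
  interpret product_sigma_finite "\<lambda>_::nat. lborel :: real measure" ..
  have Ji: "insert i (J - {i}) = J" using J by auto
  let ?P = "\<lambda>y. inf_close I b \<phi> (y(k := x)) \<longrightarrow> inf_close I (b(i := c)) \<phi> (y(k := x))"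
  have "AE y in Pi\<^sub>M (insert i (J - {i})) (\<lambda>_. lborel). ?P y"
  proof (rule AE_PiM_insert)
    have "Measurable.pred (Pi\<^sub>M J (\<lambda>_. lborel)) ?P"
      using measurable_inf_close[OF I(1,2)] by measurable
    then show "{y \<in> space (Pi\<^sub>M (insert i (J - {i})) (\<lambda>_. lborel)). ?P y}
        \<in> sets (Pi\<^sub>M (insert i (J - {i})) (\<lambda>_. lborel))"
      unfolding Ji pred_def .
    fix y :: "nat \<Rightarrow> real"
    define A where "A = {q. 1 \<le> q \<and> (\<forall>l\<in>I - {i}. \<exists>p::int.
      \<bar>real q * (y(k := x)) l - real_of_int p\<bar> < b l * \<phi> q)}"
    \<comment> \<open>Used twice below: \<open>e = b i\<close> leaves \<open>b\<close> unchanged and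
      gives the premise, \<open>e = c\<close> gives the conclusion. Since
      \<open>i \<noteq> k\<close>, setting coordinate \<open>k\<close> to \<open>x\<close> does not
      overwrite \<open>t\<close>.\<close>
    have eq: "inf_close I (b(i := e)) \<phi> (y(i := t, k := x)) \<longleftrightarrow>
      infinite {q\<in>A. \<exists>p::int. \<bar>real q * t - real_of_int p\<bar> < e * \<phi> q}" for e t
    proof -
      have "{q. 1 \<le> q \<and> (\<forall>l\<in>I. \<exists>p::int.
          \<bar>real q * (y(i := t, k := x)) l - real_of_int p\<bar> < (b(i := e)) l * \<phi> q)} =
        {q\<in>A. \<exists>p::int. \<bar>real q * t - real_of_int p\<bar> < e * \<phi> q}"
        using I(3) J(3) by (auto simp: A_def)
      then show ?thesis by (simp add: inf_close_def)
    qed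
    have "AE t in lborel. infinite {q\<in>A. \<exists>p::int. \<bar>real q * t - real_of_int p\<bar> < b i * \<phi> q} \<longrightarrow>
      infinite {q\<in>A. \<exists>p::int. \<bar>real q * t - real_of_int p\<bar> < c * \<phi> q}"
      using \<phi> c by (intro AE_infinite_close_shrink) (auto simp: A_def)
    then show "AE t in lborel. ?P (y(i := t))"
      using eq[of "b i"] eq[of c] by simp
  qed (use J in auto)
  then show ?thesis by (simp only: Ji)
qed

section \<open>Dirichlet approximation in a skew box\<close>

text \<open>Cut the unit cube into half-open boxes with side \<open>1 / m i\<close> in direction
  \<open>i\<close>. Of the multiples \<open>n * z\<close> with \<open>n\<close> from 0 to the number
  of boxes, two have fractional parts in the same box; \<open>q\<close> is the difference of their
  indices.\<close>

lemma dirichlet_box: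
  fixes z :: "'i \<Rightarrow> real" and m :: "'i \<Rightarrow> nat"
  assumes I: "finite I" and m: "\<And>i. i \<in> I \<Longrightarrow> 1 \<le> m i"
  obtains q where "1 \<le> q" "q \<le> (\<Prod>i\<in>I. m i)"
    "\<And>i. i \<in> I \<Longrightarrow> \<exists>p::int. \<bar>real q * z i - real_of_int p\<bar> < 1 / real (m i)"
proof -
  define f where "f n = (\<lambda>i\<in>I. nat \<lfloor>frac (real n * z i) * real (m i)\<rfloor>)" for n :: nat
  have "f ` {0..(\<Prod>i\<in>I. m i)} \<subseteq> (\<Pi>\<^sub>E i\<in>I. {..<m i})"
  proof (rule image_subsetI, unfold f_def, rule restrict_PiE_iff[THEN iffD2], rule ballI)
    fix n i assume "i \<in> I"
    then have "frac (real n * z i) * real (m i) < real (m i)"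
      using m[of i] frac_lt_1[of "real n * z i"] by (simp add: mult_less_cancel_right1)
    moreover have "0 \<le> frac (real n * z i) * real (m i)" by simp
    ultimately show "nat \<lfloor>frac (real n * z i) * real (m i)\<rfloor> \<in> {..<m i}"
      by (simp add: nat_less_iff floor_less_iff)
  qed
  moreover have "finite (\<Pi>\<^sub>E i\<in>I. {..<m i})" "card (\<Pi>\<^sub>E i\<in>I. {..<m i}) = (\<Prod>i\<in>I. m i)"
    using I by (auto simp: card_PiE intro: finite_PiE)
  ultimately have "card (f ` {0..(\<Prod>i\<in>I. m i)}) \<le> (\<Prod>i\<in>I. m i)"
    by (metis card_mono)
  then have "\<not> inj_on f {0..(\<Prod>i\<in>I. m i)}"
    by (intro pigeonhole) auto
  then obtain n n' where n: "n < n'" "n' \<le> (\<Prod>i\<in>I. m i)" "f n = f n'"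
    unfolding inj_on_def by (metis atLeastAtMost_iff linorder_neqE_nat)
  show thesis
  proof (rule that[of "n' - n"])
    show "1 \<le> n' - n" "n' - n \<le> (\<Prod>i\<in>I. m i)" using n by auto
    fix i assume i: "i \<in> I"
    let ?a = "frac (real n * z i) * real (m i)" and ?b = "frac (real n' * z i) * real (m i)"
    have "nat \<lfloor>?a\<rfloor> = nat \<lfloor>?b\<rfloor>" 
      using fun_cong[OF n(3), of i] i by (simp only: f_def restrict_apply')
    moreover have "0 \<le> \<lfloor>?a\<rfloor>" "0 \<le> \<lfloor>?b\<rfloor>" by simp_all
    ultimately have "\<lfloor>?a\<rfloor> = \<lfloor>?b\<rfloor>" by linarith
    then have "\<bar>?b - ?a\<bar> < 1" by linarith
    moreover have "\<bar>?b - ?a\<bar> = \<bar>frac (real n' * z i) - frac (real n * z i)\<bar> * real (m i)"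
      by (simp add: abs_mult flip: left_diff_distrib)
    ultimately have "\<bar>frac (real n' * z i) - frac (real n * z i)\<bar> < 1 / real (m i)"
      using m[OF i] by (simp add: field_simps)
    moreover have "frac (real n' * z i) - frac (real n * z i) =
      real (n' - n) * z i - real_of_int (\<lfloor>real n' * z i\<rfloor> - \<lfloor>real n * z i\<rfloor>)"
      using n(1) by (simp add: frac_def of_nat_diff algebra_simps)
    ultimately show "\<exists>p::int. \<bar>real (n' - n) * z i - real_of_int p\<bar> < 1 / real (m i)"
      by metis
  qed
qed

text \<open>The first coordinate will be the fixed \<open>x\<close>, where no null set may be
  discarded, so the small constant \<open>c\<close> is needed there for every point. A box that is
  very thin in this direction provides it, at the price of a large constant \<open>C\<close> in the
  others.\<close>

lemma inf_close_skew_dirichlet: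
  fixes c :: real
  assumes d: "2 \<le> d" and c: "0 < c"
  obtains C :: real where "0 < C"
    "\<And>z. inf_close {1..d} (\<lambda>i. if i = 1 then c else C) (\<lambda>q. real q powr (- 1 / real d)) z"
proof -
  obtain k :: nat where k: "k \<noteq> 0" "inverse (real k) < c"
    using ex_inverse_of_nat_less[OF c] by auto
  define \<phi> where "\<phi> q = real q powr (- 1 / real d)" for q :: nat
  let ?b = "\<lambda>i. if i = 1 then c else real k"
  have "inf_close {1..d} ?b \<phi> z" for z
    unfolding inf_close_def
  proof
    define Q where "Q = {q. 1 \<le> q \<and> (\<forall>i\<in>{1..d}. \<exists>p::int. \<bar>real q * z i - real_of_int p\<bar> < ?b i * \<phi> q)}"
    assume "finite {q. 1 \<le> q \<and> (\<forall>i\<in>{1..d}. \<exists>p::int. \<bar>real q * z i - real_of_int p\<bar> < ?b i * \<phi> q)}"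
    then have fin: "finite Q" by (simp add: Q_def)
    have "\<exists>q\<in>Q. \<forall>i\<in>{1..d}. \<exists>p::int. \<bar>real q * z i - real_of_int p\<bar> < 1 / real (Suc n)" for n
    proof -
      \<comment> \<open>The product of the \<open>?m i\<close> is \<open>(k * Suc n) ^ d\<close>, so
        \<open>q\<close> up to this bound gives \<open>1 / Suc n \<le> k * \<phi> q\<close>, as the
        other coordinates require. The additional factor \<open>k ^ d\<close> improves the first
        coordinate to \<open>k * \<phi> q / k ^ d\<close>, which is at most
        \<open>\<phi> q / k\<close> because \<open>d \<ge> 2\<close>, hence at most
        \<open>c * \<phi> q\<close>.\<close>
      let ?m = "\<lambda>i. (if i = 1 then k ^ d else 1) * Suc n"
      have k1: "1 \<le> k ^ d" using k by simp
      obtain q where q: "1 \<le> q" "q \<le> (\<Prod>i\<in>{1..d}. ?m i)"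
        "\<And>i. i \<in> {1..d} \<Longrightarrow> \<exists>p::int. \<bar>real q * z i - real_of_int p\<bar> < 1 / real (?m i)"
        by (rule dirichlet_box[of "{1..d}" ?m z]) (use k1 in auto)
      have "(\<Prod>i\<in>{1..d}. ?m i) = (k * Suc n) ^ d"
        using d by (simp add: prod.distrib prod.delta power_mult_distrib del: mult_Suc_right)
      then have "real q \<le> (real k * real (Suc n)) ^ d"
        using q(2) by (metis of_nat_le_iff of_nat_mult of_nat_power)
      then have "real q powr (1 / real d) \<le> ((real k * real (Suc n)) ^ d) powr (1 / real d)"
        by (intro powr_mono2) auto
      also have "\<dots> = real k * real (Suc n)"
        using d k by (simp add: powr_powr flip: powr_realpow)
      finally have "1 \<le> real k * real (Suc n) * \<phi> q"
        using q(1) by (simp add: \<phi>_def powr_minus field_simps)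
      then have bd: "1 / real (Suc n) \<le> real k * \<phi> q"
        by (simp add: field_simps)
      have "\<exists>p::int. \<bar>real q * z i - real_of_int p\<bar> < ?b i * \<phi> q \<and>
          \<bar>real q * z i - real_of_int p\<bar> < 1 / real (Suc n)" if i: "i \<in> {1..d}" for i
      proof -
        obtain p :: int where p: "\<bar>real q * z i - real_of_int p\<bar> < 1 / real (?m i)" using q(3)[OF i] by auto
        have "1 * Suc n \<le> ?m i" using k1 by (intro mult_le_mono1) auto
        then have "real (Suc n) \<le> real (?m i)" by (simp only: of_nat_le_iff mult_1)
        then have le: "1 / real (?m i) \<le> 1 / real (Suc n)"
          by (intro frac_le) auto
        have "1 / real (?m i) \<le> ?b i * \<phi> q"
        proof (cases "i = 1")
          case True
          have \<phi>0: "0 \<le> \<phi> q" by (simp add: \<phi>_def)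
          have "1 / real (?m i) = (1 / real (Suc n)) / real (k ^ d)"
            using True by (simp add: algebra_simps)
          also have "\<dots> \<le> (real k * \<phi> q) / real (k ^ d)"
            using bd by (intro divide_right_mono) auto
          also have "\<dots> \<le> (real k * \<phi> q) / real (k ^ 2)"
            using k d \<phi>0 by (intro frac_le) (auto simp flip: of_nat_power intro: power_increasing)
          also have "\<dots> = inverse (real k) * \<phi> q"
            using k by (simp add: power2_eq_square field_simps)
          also have "\<dots> \<le> c * \<phi> q" using k \<phi>0 by (intro mult_right_mono) auto
          finally show ?thesis using True by simp
        qed (use bd in auto)
        then show ?thesis using p le by (intro exI[of _ p]) linarith
      qed
      then show ?thesis using q(1) unfolding Q_def by blast
    qed
    \<comment> \<open>If \<open>Q\<close> is finite, a single \<open>q\<close> serves infinitely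
      many \<open>n\<close>. Then every \<open>q * z i\<close> is arbitrarily close to integers,
      hence an integer, and all positive multiples of \<open>q\<close> belong to \<open>Q\<close>, a
      contradiction.\<close>
    then obtain g where g: "\<And>n. g n \<in> Q"
      "\<And>n i. i \<in> {1..d} \<Longrightarrow> \<exists>p::int. \<bar>real (g n) * z i - real_of_int p\<bar> < 1 / real (Suc n)"
      by metis
    have "finite (range g)" using g(1) fin by (meson finite_subset image_subsetI)
    then obtain n0 where n0: "infinite {n. g n = g n0}"
      using pigeonhole_infinite[of UNIV g] by auto
    define q where "q = g n0"
    have q: "q \<in> Q" using g by (simp add: q_def)
    have int: "real q * z i = real_of_int (round (real q * z i))" if i: "i \<in> {1..d}" for i
    proof (rule ccontr)
      assume "real q * z i \<noteq> real_of_int (round (real q * z i))"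
      then have "0 < \<bar>real q * z i - real_of_int (round (real q * z i))\<bar>" by simp
      then obtain N where N: "inverse (real (Suc N)) < \<bar>real q * z i - real_of_int (round (real q * z i))\<bar>"
        using reals_Archimedean by blast
      obtain n where n: "n > N" "g n = q"
        using n0 unfolding infinite_nat_iff_unbounded by (auto simp: q_def)
      obtain p :: int where "\<bar>real q * z i - real_of_int p\<bar> < 1 / real (Suc n)" using g(2)[OF i, of n] n by auto
      moreover have "\<bar>real q * z i - real_of_int (round (real q * z i))\<bar> \<le> \<bar>real q * z i - real_of_int p\<bar>"
        using round_diff_minimal[of "real q * z i" p] by (simp add: abs_minus_commute)
      moreover have "1 / real (Suc n) \<le> inverse (real (Suc N))"
        using n by (simp add: field_simps)
      ultimately show False using N by linarith
    qed
    have "Suc j * q \<in> Q" for j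
      unfolding Q_def
    proof (intro CollectI conjI ballI)
      show "1 \<le> Suc j * q" using q by (auto simp: Q_def)
      fix i assume i: "i \<in> {1..d}"
      have "real (Suc j * q) * z i = real_of_int (int (Suc j) * round (real q * z i))"
        using int[OF i] by (simp add: algebra_simps)
      moreover have "0 < ?b i * \<phi> (Suc j * q)"
      proof (rule mult_pos_pos)
        have "Suc j * q \<noteq> 0" using q by (auto simp: Q_def)
        then show "0 < \<phi> (Suc j * q)" by (simp only: \<phi>_def powr_gt_zero of_nat_eq_0_iff) simp
      qed (use k c in auto)
      ultimately show "\<exists>p::int. \<bar>real (Suc j * q) * z i - real_of_int p\<bar> < ?b i * \<phi> (Suc j * q)"
        by (intro exI[of _ "int (Suc j) * round (real q * z i)"]) simp
    qed
    then have "finite (range (\<lambda>j. Suc j * q))" using fin by (meson finite_subset image_subsetI)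
    moreover have "inj (\<lambda>j. Suc j * q)" using q by (auto simp: inj_def Q_def)
    ultimately show False using finite_imageD by blast
  qed
  then show thesis using that[of "real k"] k by (simp add: \<phi>_def[abs_def])
qed

section \<open>The lower bound for \<open>\<psi>\<close> from the density hypothesis\<close>

text \<open>Otherwise there are \<open>n j\<close> with
  \<open>n j * \<psi> (n j) ^ d \<le> (1/2) ^ j\<close>. By monotonicity this bounds the sum over
  the block from \<open>n j + 1\<close> to \<open>2 * n j\<close>, so the sum over the union
  \<open>A\<close> of all blocks converges. Yet each block is half of the interval from 1 to
  \<open>2 * n j\<close>, so \<open>A\<close> does not have density 0.\<close>

lemma ge_powr_if_density_condition:
  fixes \<psi> :: "nat \<Rightarrow> real"
  assumes d: "1 \<le> d" and nonneg: "\<And>q. q \<ge> 1 \<Longrightarrow> 0 \<le> \<psi> q"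
    and anti: "antimono_on {1..} \<psi>"
    and dens: "\<And>A. A \<subseteq> {1..} \<Longrightarrow> (\<lambda>q. \<psi> q ^ d) summable_on A \<Longrightarrow> has_asymptotic_density A 0"
  shows "\<exists>c>0. \<exists>N. \<forall>q\<ge>N. c * real q powr (- 1 / real d) \<le> \<psi> q"
proof (rule ccontr)
  assume "\<not> ?thesis"
  then have small: "\<exists>q\<ge>N. \<psi> q < c * real q powr (- 1 / real d)" if "0 < c" for c N
    using that by (meson not_le)
  have "\<exists>n\<ge>Suc j. real n * \<psi> n ^ d \<le> (1/2) ^ j" for j
  proof -
    define \<epsilon> :: real where "\<epsilon> = (1/2) ^ j"
    \<comment> \<open>The constant \<open>\<epsilon> powr (1 / real d)\<close> turns into
      \<open>\<epsilon>\<close> when the bound is raised to the power \<open>d\<close>. Requiring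
      \<open>n \<ge> Suc j\<close> makes \<open>n\<close> positive and later sends the blocks to
      infinity.\<close>
    obtain n where n: "n \<ge> Suc j" "\<psi> n < \<epsilon> powr (1 / real d) * real n powr (- 1 / real d)"
      using small[of "\<epsilon> powr (1 / real d)" "Suc j"] by (auto simp: \<epsilon>_def)
    have "\<psi> n ^ d \<le> (\<epsilon> powr (1 / real d) * real n powr (- 1 / real d)) ^ d"
      using n nonneg[of n] by (intro power_mono) auto
    also have "\<dots> = \<epsilon> * (1 / real n)"
    proof -
      have "(u powr (e / real d)) ^ d = u powr e" if "0 < u" for u e :: real
        using that d by (simp add: powr_powr flip: powr_realpow)
      from this[of \<epsilon> 1] this[of "real n" "-1"] show ?thesis
        using n by (simp add: power_mult_distrib power_divide powr_minus_divide \<epsilon>_def del: powr_minus)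
    qed
    finally show ?thesis using n by (intro exI[of _ n]) (simp add: \<epsilon>_def field_simps)
  qed
  then obtain n where n: "\<And>j. Suc j \<le> n j" "\<And>j. real (n j) * \<psi> (n j) ^ d \<le> (1/2) ^ j" by metis
  define A where "A = (\<Union>j. {n j<..2 * n j})"
  have A1: "A \<subseteq> {1..}" by (auto simp: A_def)
  have "(\<lambda>q. \<psi> q ^ d) summable_on A"
  proof (rule nonneg_bdd_above_summable_on)
    show "0 \<le> \<psi> q ^ d" if "q \<in> A" for q using that A1 nonneg by auto
    show "bdd_above (sum (\<lambda>q. \<psi> q ^ d) ` {F. F \<subseteq> A \<and> finite F})"
    proof (rule bdd_aboveI2)
      fix F assume "F \<in> {F. F \<subseteq> A \<and> finite F}"
      then have F: "F \<subseteq> A" "finite F" by auto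
      then have "\<forall>q\<in>F. \<exists>j. q \<in> {n j<..2 * n j}" unfolding A_def by blast
      \<comment> \<open>The blocks may overlap or coincide; \<open>h\<close> assigns each
        \<open>q\<close> to one block, so that no term is counted twice.\<close>
      then obtain h where h: "\<And>q. q \<in> F \<Longrightarrow> q \<in> {n (h q)<..2 * n (h q)}" by metis
      have "(\<Sum>q\<in>F. \<psi> q ^ d) = (\<Sum>j\<in>h ` F. \<Sum>q\<in>{q\<in>F. h q = j}. \<psi> q ^ d)"
        by (rule sum.image_gen[OF F(2)])
      also have "\<dots> \<le> (\<Sum>j\<in>h ` F. (1/2) ^ j)"
      proof (rule sum_mono)
        fix j
        have "(\<Sum>q\<in>{q\<in>F. h q = j}. \<psi> q ^ d) \<le> (\<Sum>q\<in>{n j<..2 * n j}. \<psi> q ^ d)"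
          using h nonneg by (intro sum_mono2) auto
        also have "\<dots> \<le> (\<Sum>q\<in>{n j<..2 * n j}. \<psi> (n j) ^ d)"
        proof (intro sum_mono power_mono)
          fix q assume "q \<in> {n j<..2 * n j}"
          then show "\<psi> q \<le> \<psi> (n j)" "0 \<le> \<psi> q"
            using n(1)[of j] nonneg[of q] by (auto intro: monotone_onD[OF anti])
        qed
        also have "\<dots> \<le> (1/2) ^ j" using n(2)[of j] by simp
        finally show "(\<Sum>q\<in>{q\<in>F. h q = j}. \<psi> q ^ d) \<le> (1/2) ^ j" .
      qed
      also have "\<dots> \<le> (\<Sum>j. (1/2) ^ j)"
        using F(2) by (intro sum_le_suminf) auto
      finally show "(\<Sum>q\<in>F. \<psi> q ^ d) \<le> (\<Sum>j. (1/2) ^ j)" .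
    qed
  qed
  then have "has_asymptotic_density A 0" by (rule dens[OF A1])
  then have "eventually (\<lambda>N. real (card (A \<inter> {1..N})) / real N < 1/2) sequentially"
    unfolding has_asymptotic_density_def by (rule order_tendstoD) simp
  then obtain M where M: "\<And>N. N \<ge> M \<Longrightarrow> real (card (A \<inter> {1..N})) / real N < 1/2"
    by (auto simp: eventually_sequentially)
  \<comment> \<open>The block with index \<open>M\<close> suffices: \<open>n M > M\<close> puts its
    right end beyond the threshold \<open>M\<close>.\<close>
  have "card {n M<..2 * n M} \<le> card (A \<inter> {1..2 * n M})"
    by (intro card_mono) (auto simp: A_def)
  then have "real (n M) \<le> real (card (A \<inter> {1..2 * n M}))" by simp
  moreover have "real (card (A \<inter> {1..2 * n M})) / real (2 * n M) < 1/2"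
    using n(1)[of M] by (intro M) simp
  moreover have "0 < real (n M)" using n(1)[of M] by simp
  ultimately show False by (simp add: field_simps)
qed

section \<open>Assembling the theorem\<close>

lemma well_approximableI:
  assumes z: "z \<in> real_space {1..d}" and d: "1 \<le> d"
    and inf: "inf_close {1..d} (\<lambda>_. c) \<phi> z" and le: "\<And>q. q \<ge> N \<Longrightarrow> c * \<phi> q \<le> \<psi> q"
  shows "z \<in> well_approximable d \<psi>"
proof -
  define Q where "Q = {q. 1 \<le> q \<and> (\<forall>i\<in>{1..d}. \<exists>p::int. \<bar>real q * z i - real_of_int p\<bar> < c * \<phi> q)}"
  have Q: "infinite (Q - {..<N})" using inf by (simp add: inf_close_def Q_def)
  define near where "near q = (\<lambda>i\<in>{1..d}. round (real q * z i))" for q :: nat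
  have "(\<lambda>q. (near q, q)) ` (Q - {..<N}) \<subseteq> {(p, q). p \<in> int_space {1..d} \<and> q \<ge> 1 \<and>
      sup_norm {1..d} (\<lambda>i. real q * z i - real_of_int (p i)) < \<psi> q}"
  proof (rule image_subsetI, simp only: mem_Collect_eq prod.case, intro conjI)
    fix q assume "q \<in> Q - {..<N}"
    then have q: "q \<in> Q" "N \<le> q" by auto
    show "near q \<in> int_space {1..d}" by (simp add: near_def int_space_def)
    show "1 \<le> q" using q by (simp add: Q_def)
    have "\<bar>real q * z i - real_of_int (near q i)\<bar> < \<psi> q" if i: "i \<in> {1..d}" for i
    proof -
      obtain p :: int where "\<bar>real q * z i - real_of_int p\<bar> < c * \<phi> q" using q(1) i unfolding Q_def by blast
      moreover have "\<bar>real q * z i - real_of_int (near q i)\<bar> \<le> \<bar>real q * z i - real_of_int p\<bar>"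
        using round_diff_minimal[of "real q * z i" p] i by (simp add: near_def abs_minus_commute)
      ultimately show ?thesis using le[of q] q by linarith
    qed
    then show "sup_norm {1..d} (\<lambda>i. real q * z i - real_of_int (near q i)) < \<psi> q"
      using d unfolding sup_norm_def by (subst Max_less_iff) auto
  qed
  moreover have "infinite ((\<lambda>q. (near q, q)) ` (Q - {..<N}))"
    using Q by (subst finite_image_iff) (auto simp: inj_on_def)
  ultimately show ?thesis
    using z unfolding well_approximable_def by (blast dest: finite_subset)
qed

theorem theorem4:
  fixes d :: nat and \<psi> :: "nat \<Rightarrow> real" and x :: real
  assumes "d \<ge> 3"
    and "\<And>q. q \<ge> 1 \<Longrightarrow> 0 \<le> \<psi> q"
    and "antimono_on {1..} \<psi>"
    and "\<And>A. A \<subseteq> {1..} \<Longrightarrow> (\<lambda>q. \<psi> q ^ d) summable_on A \<Longrightarrow> has_asymptotic_density A 0"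
  shows "AE y in lebesgue_space {2..d}. y(1 := x) \<in> well_approximable d \<psi>"
proof -
  define \<phi> where "\<phi> q = real q powr (- 1 / real d)" for q :: nat
  obtain c N where c: "0 < c" "\<And>q. q \<ge> N \<Longrightarrow> c * \<phi> q \<le> \<psi> q"
    using ge_powr_if_density_condition[of d \<psi>] assms unfolding \<phi>_def by auto
  obtain C where C: "\<And>z. inf_close {1..d} (\<lambda>i. if i = 1 then c else C) \<phi> z"
    using inf_close_skew_dirichlet[of d c] assms(1) c(1) unfolding \<phi>_def[abs_def] by auto
  have \<phi>0: "0 < \<phi> q" if "1 \<le> q" for q using that by (simp add: \<phi>_def)
  have lim: "(\<lambda>q. \<phi> q / real q) \<longlonglongrightarrow> 0"
  proof (rule Lim_null_comparison)
    show "eventually (\<lambda>q. norm (\<phi> q / real q) \<le> 1 / real q) sequentially"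
      using eventually_ge_at_top[of 1]
    proof eventually_elim
      case (elim q)
      then have "real q powr (- 1 / real d) \<le> real q powr 0" by (intro powr_mono) auto
      then show ?case using elim by (simp add: \<phi>_def field_simps)
    qed
  qed (rule lim_1_over_n)
  let ?M = "Pi\<^sub>M {2..d} (\<lambda>_. lborel :: real measure)"
  have I: "{1..d} \<subseteq> insert 1 {2..d}" by auto
  \<comment> \<open>\<open>S\<close> is the set of coordinates in which \<open>C\<close> has already
    been replaced by \<open>c\<close>. For empty \<open>S\<close> this is the skew Dirichlet
    statement, valid for every \<open>y\<close>; each further coordinate costs one null set.\<close>
  have "AE y in ?M. inf_close {1..d} (\<lambda>i. if i = 1 \<or> i \<in> S then c else C) \<phi> (y(1 := x))"
    if "finite S" "S \<subseteq> {2..d}" for S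
    using that
  proof (induction rule: finite_subset_induct')
    case empty
    then show ?case using C by simp
  next
    case (insert i S)
    let ?b = "\<lambda>S i. if i = 1 \<or> i \<in> S then c else C"
    have eq: "(?b S)(i := c) = ?b (insert i S)" by auto
    have "AE y in ?M. inf_close {1..d} (?b S) \<phi> (y(1 := x)) \<longrightarrow>
        inf_close {1..d} ((?b S)(i := c)) \<phi> (y(1 := x))"
      using insert.hyps I \<phi>0 lim c(1) by (intro AE_inf_close_update) auto
    then show ?case using insert.IH unfolding eq by eventually_elim blast
  qed
  from this[of "{2..d}"]
  have "AE y in ?M. inf_close {1..d} (\<lambda>i. if i = 1 \<or> i \<in> {2..d} then c else C) \<phi> (y(1 := x))"
    by simp
  then have "AE y in ?M. y(1 := x) \<in> well_approximable d \<psi>"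
  proof (rule AE_mp, intro AE_I2 impI)
    fix y :: "nat \<Rightarrow> real"
    assume y: "y \<in> space ?M"
      and inf: "inf_close {1..d} (\<lambda>i. if i = 1 \<or> i \<in> {2..d} then c else C) \<phi> (y(1 := x))"
    have "inf_close {1..d} (\<lambda>_. c) \<phi> (y(1 := x))"
      using inf by (subst inf_close_cong[of _ _ "\<lambda>i. if i = 1 \<or> i \<in> {2..d} then c else C"]) auto
    moreover have "y(1 := x) \<in> real_space {1..d}"
      using y assms(1) by (auto simp: space_PiM real_space_def PiE_iff extensional_def)
    ultimately show "y(1 := x) \<in> well_approximable d \<psi>"
      using assms(1) c(2) by (intro well_approximableI) auto
  qed
  then show ?thesis unfolding lebesgue_space_def by (rule AE_completion)
qed

end
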